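(* Let $\alpha>0$, $\beta\ge0$, $N\ge 1$, let $h^1,\dots,h^N$ be strictly convex functions on $\mathcal X$ with mirror maps $\nabla(h^i)^*:\mathbb R^n\to\mathcal X$, and let $S,\Phi,T$ satisfy: (C1) $S$ is $\sigma$-strongly monotone with respect to some norm for some $\sigma>0$; (C2) some $\bar x\in\mathcal X$ is variationally stable with respect to $\Phi$; (C3) $\operatorname{SOL}(\mathcal X,\Phi)\subseteq\operatorname{SOL}(\mathcal X,F)$; (C4) $T=(S+\Phi+\mathcal N_{\mathcal X})^{-1}\circ S$ is well-defined. Consider the ensemble dynamics, with arbitrary initial dual states $z^i(0)\in\mathbb R^n$, for $i=1,\dots,N$, $$\dot z^i(t)=\alpha\big(S(T(x^{\mathrm{en}}(t)))-S(x^{\mathrm{en}}(t))\big)-\beta\Phi(x^{\mathrm{en}}(t)),\qquad x^i(t)=\nabla(h^i)^*(z^i(t)),\qquad x^{\mathrm{en}}(t)=\frac1N\sum_{k=1}^N x^k(t).$$ Then the ensemble state $x^{\mathrm{en}}$ satisfies, for a dual trajectory $z$ with $z(0)=0$, $$\dot z(t)=\alpha\big(S(T(x^{\mathrm{en}}(t)))-S(x^{\mathrm{en}}(t))\big)-\beta\Phi(x^{\mathrm{en}}(t)),\qquad x^{\mathrm{en}}(t)=\nabla(h^{\mathrm{en}})^*(z(t)),$$ where $h^{\mathrm{en}}=\bar h^1\,\square\,\cdots\,\square\,\bar h^N$ and $\bar h^i(x)=\frac1N h^i(Nx)-\langle z^i(0),x\rangle$.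
   Context: $\mathcal X\subseteq\mathbb R^n$ is nonempty, closed and convex, and $F:\mathcal X\to\mathbb R^n$ is continuous. For $G:\mathcal X\to\mathbb R^n$, $\operatorname{SOL}(\mathcal X,G)$ is the set of $x^*\in\mathcal X$ with $G(x^* )^\top(x-x^* )\ge 0$ for all $x\in\mathcal X$. Standing assumption: $\operatorname{SOL}(\mathcal X,F)\ne\emptyset$. $S,\Phi:\mathcal X\to\mathbb R^n$ and $T:\mathcal X\to\mathcal X$ are design functions. $S$ is $\sigma$-strongly monotone w.r.t. $\|\cdot\|$ if $(S(x)-S(y))^\top(x-y)\ge\sigma\|x-y\|^2$ for all $x,y\in\mathcal X$. $\bar x\in\mathcal X$ is variationally stable w.r.t. $\Phi$ if $\Phi(x)^\top(x-\bar x)\ge0$ for all $x\in\mathcal X$. $\mathcal N_{\mathcal X}(y)$ is the normal cone of $\mathcal X$ at $y$; $T$ well-defined means that for each $x\in\mathcal X$ there is exactly one $y=:T(x)\in\mathcal X$ with $S(x)\in S(y)+\Phi(y)+\mathcal N_{\mathcal X}(y)$. Functions on $\mathcal X$ are extended by $+\infty$ outside $\mathcal X$. $f^*(z)=\sup_x\{\langle z,x\rangle-f(x)\}$ is the convex conjugate. The infimal convolution of $f,g:\mathbb R^n\to\mathbb R\cup\{+\infty\}$ is $(f\,\square\, g)(v)=\inf\{f(a)+g(b): a,b\in\mathbb R^n,\ a+b=v\}$. *)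

theory Defs
  imports "HOL-Analysis.Analysis"
begin

definition SOL :: "(real^'n) set \<Rightarrow> (real^'n \<Rightarrow> real^'n) \<Rightarrow> (real^'n) set" where
  "SOL X G = {xs \<in> X. \<forall>x\<in>X. G xs \<bullet> (x - xs) \<ge> 0}"

text \<open>An arbitrary norm on \<open>\<real>\<^sup>n\<close>, as opposed to the Euclidean one provided by the type class.\<close>

definition is_norm :: "(real^'n \<Rightarrow> real) \<Rightarrow> bool" where
  "is_norm p \<longleftrightarrow>
     (\<forall>x. p x \<ge> 0) \<and> (\<forall>x. p x = 0 \<longleftrightarrow> x = 0) \<and>
     (\<forall>c x. p (c *\<^sub>R x) = \<bar>c\<bar> * p x) \<and> (\<forall>x y. p (x + y) \<le> p x + p y)"

definition strongly_monotone ::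
  "(real^'n) set \<Rightarrow> (real^'n \<Rightarrow> real) \<Rightarrow> real \<Rightarrow> (real^'n \<Rightarrow> real^'n) \<Rightarrow> bool" where
  "strongly_monotone X p \<sigma> S \<longleftrightarrow>
     (\<forall>x\<in>X. \<forall>y\<in>X. (S x - S y) \<bullet> (x - y) \<ge> \<sigma> * (p (x - y))\<^sup>2)"

definition variationally_stable ::
  "(real^'n) set \<Rightarrow> (real^'n \<Rightarrow> real^'n) \<Rightarrow> real^'n \<Rightarrow> bool" where
  "variationally_stable X \<Phi> xb \<longleftrightarrow> xb \<in> X \<and> (\<forall>x\<in>X. \<Phi> x \<bullet> (x - xb) \<ge> 0)"

definition normal_cone :: "(real^'n) set \<Rightarrow> real^'n \<Rightarrow> (real^'n) set" where
  "normal_cone X y = (if y \<in> X then {v. \<forall>x\<in>X. v \<bullet> (x - y) \<le> 0} else {})"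

text \<open>\<open>T = (S + \<Phi> + N\<^sub>X)\<^sup>-\<^sup>1 \<circ> S\<close> on \<open>X\<close>, with the right-hand side single-valued.\<close>

definition resolvent_well_defined ::
  "(real^'n) set \<Rightarrow> (real^'n \<Rightarrow> real^'n) \<Rightarrow> (real^'n \<Rightarrow> real^'n) \<Rightarrow> (real^'n \<Rightarrow> real^'n) \<Rightarrow> bool" where
  "resolvent_well_defined X S \<Phi> T \<longleftrightarrow>
     (\<forall>x\<in>X. (\<exists>!y. y \<in> X \<and> S x \<in> {S y + \<Phi> y + v |v. v \<in> normal_cone X y}) \<and>
            T x \<in> X \<and> S x \<in> {S (T x) + \<Phi> (T x) + v |v. v \<in> normal_cone X (T x)})"

definition strictly_convex_on :: "(real^'n) set \<Rightarrow> (real^'n \<Rightarrow> real) \<Rightarrow> bool" where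
  "strictly_convex_on X f \<longleftrightarrow> convex X \<and>
     (\<forall>x\<in>X. \<forall>y\<in>X. \<forall>u. x \<noteq> y \<longrightarrow> 0 < u \<longrightarrow> u < 1 \<longrightarrow>
        f ((1 - u) *\<^sub>R x + u *\<^sub>R y) < (1 - u) * f x + u * f y)"

definition extend_infty :: "(real^'n) set \<Rightarrow> (real^'n \<Rightarrow> real) \<Rightarrow> real^'n \<Rightarrow> ereal" where
  "extend_infty X f x = (if x \<in> X then ereal (f x) else \<infinity>)"

definition conjugate :: "(real^'n \<Rightarrow> ereal) \<Rightarrow> real^'n \<Rightarrow> ereal" where
  "conjugate f z = (SUP x. ereal (z \<bullet> x) - f x)"

text \<open>Since \<open>\<infinity> + (-\<infinity>) = \<infinity>\<close> in type \<open>ereal\<close>, this is the usual infimal convolution whenever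
  neither argument takes the value \<open>-\<infinity>\<close>.\<close>

definition infconv :: "(real^'n \<Rightarrow> ereal) \<Rightarrow> (real^'n \<Rightarrow> ereal) \<Rightarrow> real^'n \<Rightarrow> ereal" where
  "infconv f g v = Inf {f a + g b |a b. a + b = v}"

text \<open>\<open>((f 1 \<box> f 2) \<box> \<dots>) \<box> f N\<close>, for \<open>N \<ge> 1\<close>.\<close>

definition infconv_upto :: "nat \<Rightarrow> (nat \<Rightarrow> real^'n \<Rightarrow> ereal) \<Rightarrow> real^'n \<Rightarrow> ereal" where
  "infconv_upto N f = foldl infconv (f 1) (map f [2..<Suc N])"

text \<open>Gradient of an extended-real-valued function at a point near which it is finite; the
  finiteness is needed because \<open>real_of_ereal\<close> sends infinite values to \<open>0\<close>.\<close>

definition has_gradient :: "(real^'n \<Rightarrow> ereal) \<Rightarrow> real^'n \<Rightarrow> real^'n \<Rightarrow> bool" where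
  "has_gradient g z d \<longleftrightarrow>
     (\<forall>\<^sub>F w in nhds z. \<bar>g w\<bar> \<noteq> \<infinity>) \<and> GDERIV (\<lambda>w. real_of_ereal (g w)) z :> d"

definition mirror_map :: "(real^'n \<Rightarrow> ereal) \<Rightarrow> real^'n \<Rightarrow> real^'n" where
  "mirror_map f z = (THE d. has_gradient (conjugate f) z d)"

text \<open>\<open>\<nabla>f\<^sup>*\<close> is a well-defined map \<open>\<real>\<^sup>n \<rightarrow> X\<close>.\<close>

definition has_mirror_map :: "(real^'n) set \<Rightarrow> (real^'n \<Rightarrow> ereal) \<Rightarrow> bool" where
  "has_mirror_map X f \<longleftrightarrow>
     (\<forall>z. has_gradient (conjugate f) z (mirror_map f z) \<and> mirror_map f z \<in> X)"

text \<open>\<open>x \<mapsto> 1/N h(N x) - \<langle>z0, x\<rangle>\<close>\<close>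

definition tilted_scaling :: "nat \<Rightarrow> (real^'n \<Rightarrow> ereal) \<Rightarrow> real^'n \<Rightarrow> real^'n \<Rightarrow> ereal" where
  "tilted_scaling N h z0 x = ereal (1 / real N) * h (real N *\<^sub>R x) - ereal (z0 \<bullet> x)"

definition ensemble_regularizer ::
  "(real^'n) set \<Rightarrow> nat \<Rightarrow> (nat \<Rightarrow> real^'n \<Rightarrow> real) \<Rightarrow> (nat \<Rightarrow> real^'n) \<Rightarrow> real^'n \<Rightarrow> ereal" where
  "ensemble_regularizer X N h z0 =
     infconv_upto N (\<lambda>i. tilted_scaling N (extend_infty X (h i)) (z0 i))"

end

theory Submission
  imports Defs
begin

text \<open>
  Why the ensemble follows a single mirror dynamics. All players receive the same dual velocity, so
  \<open>z\<^sup>i(t) - z\<^sup>i(0)\<close> does not depend on \<open>i\<close>; call this common displacement \<open>z(t)\<close>. It starts at \<open>0\<close>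
  and obeys the stated differential equation. The ensemble state is then the average of
  \<open>\<nabla>(h\<^sup>i)\<^sup>*(z(t) + z\<^sup>i(0))\<close>, and it remains to recognise this average as one mirror map.

  Conjugation does this. It turns infimal convolution into addition (\<open>conjugate_infconv\<close>,
  \<open>conjugate_infconv_upto\<close>), while subtracting a linear function shifts the argument of the
  conjugate and the scaling \<open>h \<mapsto> h(N \<cdot>) / N\<close> divides the conjugate by \<open>N\<close>
  (\<open>conjugate_tilted_scaling\<close>). Hence the conjugate of the ensemble regularizer is
  \<open>w \<mapsto> 1/N \<Sum>\<^sub>i (h\<^sup>i)\<^sup>*(w + z\<^sup>i(0))\<close>, whose gradient is exactly the required average; it lies in
  \<open>X\<close> because \<open>X\<close> is convex.

  The existence of the mirror maps makes each \<open>(h\<^sup>i)\<^sup>*\<close> finite everywhere. This is what keeps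
  the extended arithmetic free of \<open>\<infinity> - \<infinity>\<close>, and finiteness is propagated through
  the iterated infimal convolution together with the value of the conjugate.
\<close>

section \<open>Conjugates of infimal convolutions\<close>

text \<open>A real upper bound on the conjugate is the same as an affine minorant of the function. The
  conjugates below are computed through this equivalence, which avoids manipulating suprema of
  extended reals.\<close>

lemma conjugate_le_iff_affine_minorant:
  "conjugate f w \<le> ereal c \<longleftrightarrow> (\<forall>a. ereal (w \<bullet> a - c) \<le> f a)"
proof -
  have "ereal (w \<bullet> a) - f a \<le> ereal c \<longleftrightarrow> ereal (w \<bullet> a - c) \<le> f a" for a
    by (cases "f a") auto
  then show ?thesis
    by (simp add: conjugate_def SUP_le_iff)
qed

lemma ereal_eq_real_iff_upper_bounds:
  "e = ereal c \<longleftrightarrow> (\<forall>d. e \<le> ereal d \<longleftrightarrow> c \<le> d)"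
proof
  assume *: "\<forall>d. e \<le> ereal d \<longleftrightarrow> c \<le> d"
  show "e = ereal c"
  proof (cases e)
    case (real r)
    with * have "r \<le> d \<longleftrightarrow> c \<le> d" for d by simp
    with real show ?thesis by (metis order_antisym order_refl)
  next
    case PInf
    then show ?thesis using * by auto
  next
    case MInf
    then have "c \<le> c - 1" using * by (metis ereal_less_eq(2))
    then show ?thesis by simp
  qed
qed auto

lemma conjugate_infconv:
  assumes f: "conjugate f w = ereal c" and g: "conjugate g w = ereal d"
  shows "conjugate (infconv f g) w = ereal (c + d)"
proof -
  have f_ge: "ereal (w \<bullet> a - e) \<le> f a" if "c \<le> e" for a e
    using that f conjugate_le_iff_affine_minorant[of f w e] by simp
  have g_ge: "ereal (w \<bullet> b - e) \<le> g b" if "d \<le> e" for b e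
    using that g conjugate_le_iff_affine_minorant[of g w e] by simp
  have minorant: "conjugate (infconv f g) w \<le> ereal r \<longleftrightarrow>
      (\<forall>a b. ereal (w \<bullet> (a + b) - r) \<le> f a + g b)" for r
    unfolding conjugate_le_iff_affine_minorant infconv_def le_Inf_iff by blast
  have "conjugate (infconv f g) w \<le> ereal r \<longleftrightarrow> c + d \<le> r" for r
  proof
    assume "c + d \<le> r"
    have "ereal (w \<bullet> (a + b) - r) \<le> f a + g b" for a b
    proof -
      have "ereal (w \<bullet> (a + b) - r) \<le> ereal (w \<bullet> a - c) + ereal (w \<bullet> b - d)"
        using \<open>c + d \<le> r\<close> by (simp add: inner_add_right)
      also have "\<dots> \<le> f a + g b"
        by (intro add_mono f_ge g_ge order_refl)
      finally show ?thesis .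
    qed
    then show "conjugate (infconv f g) w \<le> ereal r"
      by (simp add: minorant)
  next
    assume "conjugate (infconv f g) w \<le> ereal r"
    then have le: "ereal (w \<bullet> (a + b) - r) \<le> f a + g b" for a b
      by (simp add: minorant)
    \<comment> \<open>Freeze \<open>b\<close> in the effective domain of \<open>g\<close>: what is left is an affine minorant of \<open>f\<close>.\<close>
    have "d \<le> r - c"
    proof -
      have "ereal (w \<bullet> b - (r - c)) \<le> g b" for b
      proof (cases "g b")
        case (real s)
        have "ereal (w \<bullet> a - (r - w \<bullet> b + s)) \<le> f a" for a
          using le[of a b] real f_ge[of c a]
          by (cases "f a") (auto simp: inner_add_right)
        then have "conjugate f w \<le> ereal (r - w \<bullet> b + s)"
          by (simp add: conjugate_le_iff_affine_minorant)
        then show ?thesis using f real by simp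
      next
        case MInf
        then show ?thesis using g_ge[of d b] by simp
      qed simp
      then have "conjugate g w \<le> ereal (r - c)"
        by (simp add: conjugate_le_iff_affine_minorant)
      then show ?thesis using g by simp
    qed
    then show "c + d \<le> r" by simp
  qed
  then show ?thesis
    by (simp add: ereal_eq_real_iff_upper_bounds)
qed

lemma infconv_upto_Suc:
  assumes "1 \<le> N"
  shows "infconv_upto (Suc N) f = infconv (infconv_upto N f) (f (Suc N))"
  using assms by (simp add: infconv_upto_def)

lemma conjugate_infconv_upto:
  assumes "1 \<le> N" and "\<And>i. i \<in> {1..N} \<Longrightarrow> conjugate (f i) w = ereal (c i)"
  shows "conjugate (infconv_upto N f) w = ereal (\<Sum>i=1..N. c i)"
  using assms
proof (induction N rule: dec_induct)
  case base
  then show ?case by (simp add: infconv_upto_def)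
next
  case (step N)
  then show ?case
    by (simp add: infconv_upto_Suc conjugate_infconv)
qed

section \<open>The conjugate of the ensemble regularizer\<close>

text \<open>Substituting \<open>y = N x\<close> gives
  \<open>\<langle>w, x\<rangle> - h(N x) / N + \<langle>z0, x\<rangle> = (\<langle>w + z0, y\<rangle> - h y) / N\<close>.\<close>

lemma conjugate_tilted_scaling:
  assumes "1 \<le> N" and h: "conjugate h (w + z0) = ereal c"
  shows "conjugate (tilted_scaling N h z0) w = ereal (c / real N)"
proof -
  have N: "real N > 0" using assms by simp
  have scaled: "ereal (w \<bullet> a - r) \<le> tilted_scaling N h z0 a \<longleftrightarrow>
      ereal ((w + z0) \<bullet> (real N *\<^sub>R a) - real N * r) \<le> h (real N *\<^sub>R a)" for a r
    using N by (cases "h (real N *\<^sub>R a)")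
      (auto simp: tilted_scaling_def inner_add_left field_simps)
  have "conjugate (tilted_scaling N h z0) w \<le> ereal r \<longleftrightarrow> c / real N \<le> r" for r
  proof -
    have "conjugate (tilted_scaling N h z0) w \<le> ereal r \<longleftrightarrow>
        (\<forall>a. ereal ((w + z0) \<bullet> (real N *\<^sub>R a) - real N * r) \<le> h (real N *\<^sub>R a))"
      by (simp only: conjugate_le_iff_affine_minorant scaled)
    also have "\<dots> \<longleftrightarrow> (\<forall>y. ereal ((w + z0) \<bullet> y - real N * r) \<le> h y)"
    proof (intro iffI allI)
      fix y
      assume "\<forall>a. ereal ((w + z0) \<bullet> (real N *\<^sub>R a) - real N * r) \<le> h (real N *\<^sub>R a)"
      from this[rule_format, of "(1 / real N) *\<^sub>R y"]
      show "ereal ((w + z0) \<bullet> y - real N * r) \<le> h y" using N by simp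
    qed blast
    also have "\<dots> \<longleftrightarrow> c / real N \<le> r"
      using N h by (simp flip: conjugate_le_iff_affine_minorant add: field_simps)
    finally show ?thesis .
  qed
  then show ?thesis
    by (simp add: ereal_eq_real_iff_upper_bounds)
qed

lemma has_gradient_unique:
  assumes "has_gradient g z d" and "has_gradient g z e"
  shows "d = e"
proof -
  have "(\<lambda>v. v \<bullet> d) = (\<lambda>v. v \<bullet> e)"
    using assms unfolding has_gradient_def gderiv_def
    by (blast intro: has_derivative_unique)
  then show ?thesis
    by (simp only: fun_eq_iff vector_eq_ldot)
qed

lemma mirror_map_eq:
  assumes "has_gradient (conjugate f) z d"
  shows "mirror_map f z = d"
  unfolding mirror_map_def using assms has_gradient_unique by blast

lemma has_gradient_finite:
  assumes "has_gradient g z d"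
  shows "g z = ereal (real_of_ereal (g z))"
  using assms eventually_nhds_x_imp_x[of "\<lambda>w. \<bar>g w\<bar> \<noteq> \<infinity>" z]
  by (simp add: has_gradient_def ereal_real')

text \<open>The conjugate is a finite sum of shifted conjugates, each differentiable because it is the
  potential of a mirror map, so the gradient passes through the sum.\<close>

lemma has_gradient_conjugate_ensemble_regularizer:
  assumes "1 \<le> N" and mm: "\<And>i. i \<in> {1..N} \<Longrightarrow> has_mirror_map X (extend_infty X (h i))"
  shows "has_gradient (conjugate (ensemble_regularizer X N h z0)) w
    ((1 / real N) *\<^sub>R (\<Sum>i=1..N. mirror_map (extend_infty X (h i)) (w + z0 i)))"
proof -
  define \<phi> where "\<phi> i u = real_of_ereal (conjugate (extend_infty X (h i)) u)" for i u
  let ?m = "\<lambda>i. mirror_map (extend_infty X (h i)) (w + z0 i)"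
  have grad: "has_gradient (conjugate (extend_infty X (h i))) u
      (mirror_map (extend_infty X (h i)) u)" if "i \<in> {1..N}" for i u
    using mm[OF that] by (simp add: has_mirror_map_def)
  have fin: "conjugate (extend_infty X (h i)) u = ereal (\<phi> i u)" if "i \<in> {1..N}" for i u
    unfolding \<phi>_def by (rule has_gradient_finite[OF grad[OF that]])
  have conj: "conjugate (ensemble_regularizer X N h z0) u =
      ereal (\<Sum>i=1..N. \<phi> i (u + z0 i) / real N)" for u
    unfolding ensemble_regularizer_def
    by (intro conjugate_infconv_upto conjugate_tilted_scaling fin \<open>1 \<le> N\<close>)
  have "((\<lambda>u. \<phi> i (u + z0 i)) has_derivative (\<lambda>v. v \<bullet> ?m i)) (at w)" if "i \<in> {1..N}" for i
  proof -
    have "(\<phi> i has_derivative (\<lambda>v. v \<bullet> ?m i)) (at (w + z0 i))"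
      using grad[OF that, of "w + z0 i"] unfolding has_gradient_def gderiv_def \<phi>_def by simp
    moreover have "((\<lambda>u. u + z0 i) has_derivative (\<lambda>v. v)) (at w)"
      by (auto intro!: derivative_eq_intros)
    ultimately show ?thesis
      using has_derivative_compose by blast
  qed
  then have "((\<lambda>u. \<Sum>i=1..N. \<phi> i (u + z0 i) / real N) has_derivative
      (\<lambda>v. \<Sum>i=1..N. (v \<bullet> ?m i) / real N)) (at w)"
    by (intro has_derivative_sum bounded_linear.has_derivative[OF bounded_linear_divide])
  moreover have "(\<lambda>v. \<Sum>i=1..N. (v \<bullet> ?m i) / real N) =
      (\<lambda>v. v \<bullet> ((1 / real N) *\<^sub>R (\<Sum>i=1..N. ?m i)))"
    by (simp add: inner_sum_right sum_divide_distrib)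
  ultimately show ?thesis
    by (simp add: has_gradient_def gderiv_def conj)
qed

lemma mirror_map_ensemble_regularizer:
  assumes "1 \<le> N" and "\<And>i. i \<in> {1..N} \<Longrightarrow> has_mirror_map X (extend_infty X (h i))"
  shows "mirror_map (ensemble_regularizer X N h z0) w =
    (1 / real N) *\<^sub>R (\<Sum>i=1..N. mirror_map (extend_infty X (h i)) (w + z0 i))"
  by (intro mirror_map_eq has_gradient_conjugate_ensemble_regularizer assms)

lemma has_mirror_map_ensemble_regularizer:
  assumes "convex X" and "1 \<le> N"
    and mm: "\<And>i. i \<in> {1..N} \<Longrightarrow> has_mirror_map X (extend_infty X (h i))"
  shows "has_mirror_map X (ensemble_regularizer X N h z0)"
proof -
  have "(1 / real N) *\<^sub>R (\<Sum>i=1..N. mirror_map (extend_infty X (h i)) (w + z0 i)) \<in> X" for w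
  proof -
    have "(\<Sum>i=1..N. (1 / real N) *\<^sub>R mirror_map (extend_infty X (h i)) (w + z0 i)) \<in> X"
      using assms by (intro convex_sum) (auto simp: has_mirror_map_def)
    then show ?thesis by (simp add: scaleR_sum_right)
  qed
  moreover have "mirror_map (ensemble_regularizer X N h z0) w =
      (1 / real N) *\<^sub>R (\<Sum>i=1..N. mirror_map (extend_infty X (h i)) (w + z0 i))" for w
    by (rule mirror_map_ensemble_regularizer) (use assms in auto)
  moreover have "has_gradient (conjugate (ensemble_regularizer X N h z0)) w
      ((1 / real N) *\<^sub>R (\<Sum>i=1..N. mirror_map (extend_infty X (h i)) (w + z0 i)))" for w
    by (rule has_gradient_conjugate_ensemble_regularizer) (use assms in auto)
  ultimately show ?thesis
    by (simp add: has_mirror_map_def)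
qed

section \<open>The ensemble dynamics\<close>

lemma same_derivative_imp_same_displacement:
  fixes f g :: "real \<Rightarrow> 'a::real_normed_vector"
  assumes "\<And>t. 0 \<le> t \<Longrightarrow> (f has_vector_derivative v t) (at t within {0..})"
    and "\<And>t. 0 \<le> t \<Longrightarrow> (g has_vector_derivative v t) (at t within {0..})"
    and "0 \<le> t"
  shows "f t - f 0 = g t - g 0"
proof -
  have "((\<lambda>s. f s - g s) has_vector_derivative 0) (at s within {0..})" if "s \<in> {0..}" for s
    using has_vector_derivative_diff[OF assms(1,2)[of s]] that by simp
  then obtain c where "\<And>s. s \<in> {0..} \<Longrightarrow> f s - g s = c"
    using has_vector_derivative_zero_constant[of "{0::real..}" "\<lambda>s. f s - g s"] by auto
  from this[of t] this[of 0] \<open>0 \<le> t\<close> have "f t - g t = f 0 - g 0" by simp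
  then show ?thesis by (simp add: algebra_simps)
qed

theorem theorem2:
  fixes X :: "(real^'n) set"
    and F S \<Phi> T :: "real^'n \<Rightarrow> real^'n"
    and h :: "nat \<Rightarrow> real^'n \<Rightarrow> real"
    and z x :: "nat \<Rightarrow> real \<Rightarrow> real^'n"
    and xen :: "real \<Rightarrow> real^'n"
    and \<alpha> \<beta> :: real and N :: nat
  assumes "X \<noteq> {}" and "closed X" and "convex X"
    and "continuous_on X F" and "SOL X F \<noteq> {}"
    and "\<alpha> > 0" and "\<beta> \<ge> 0" and "N \<ge> 1"
    and "\<And>i. i \<in> {1..N} \<Longrightarrow> strictly_convex_on X (h i)"
    and "\<And>i. i \<in> {1..N} \<Longrightarrow> has_mirror_map X (extend_infty X (h i))"
    and C1: "\<exists>p \<sigma>. is_norm p \<and> \<sigma> > 0 \<and> strongly_monotone X p \<sigma> S"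
    and C2: "\<exists>xb. variationally_stable X \<Phi> xb"
    and C3: "SOL X \<Phi> \<subseteq> SOL X F"
    and C4: "resolvent_well_defined X S \<Phi> T"
    and "\<And>i t. i \<in> {1..N} \<Longrightarrow> t \<ge> 0 \<Longrightarrow>
      (z i has_vector_derivative (\<alpha> *\<^sub>R (S (T (xen t)) - S (xen t)) - \<beta> *\<^sub>R \<Phi> (xen t)))
        (at t within {0..})"
    and "\<And>i t. i \<in> {1..N} \<Longrightarrow> t \<ge> 0 \<Longrightarrow> x i t = mirror_map (extend_infty X (h i)) (z i t)"
    and "\<And>t. t \<ge> 0 \<Longrightarrow> xen t = (1 / real N) *\<^sub>R (\<Sum>k=1..N. x k t)"
  defines "hen \<equiv> ensemble_regularizer X N h (\<lambda>i. z i 0)"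
  shows "has_mirror_map X hen \<and>
    (\<exists>zen :: real \<Rightarrow> real^'n. zen 0 = 0 \<and>
      (\<forall>t\<ge>0. (zen has_vector_derivative
          (\<alpha> *\<^sub>R (S (T (xen t)) - S (xen t)) - \<beta> *\<^sub>R \<Phi> (xen t))) (at t within {0..}) \<and>
        xen t = mirror_map hen (zen t)))"
proof -
  let ?v = "\<lambda>t. \<alpha> *\<^sub>R (S (T (xen t)) - S (xen t)) - \<beta> *\<^sub>R \<Phi> (xen t)"
  note mm = assms(10) and ode = assms(15) and primal = assms(16) and average = assms(17)
  \<comment> \<open>Any player serves as the reference for the common dual displacement; \<open>N \<ge> 1\<close> provides the first.\<close>
  define zen where "zen t = z 1 t - z 1 0" for t
  have one: "1 \<in> {1..N}" using \<open>N \<ge> 1\<close> by simp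
  have displacement: "z i t = zen t + z i 0" if "i \<in> {1..N}" "t \<ge> 0" for i t
  proof -
    have "z i t - z i 0 = zen t"
      unfolding zen_def
      by (rule same_derivative_imp_same_displacement[of _ ?v])
        (use ode that one in auto)
    then show ?thesis by (simp add: algebra_simps)
  qed
  have "(zen has_vector_derivative ?v t) (at t within {0..})" if "t \<ge> 0" for t
    using has_vector_derivative_diff[OF ode[OF one that] has_vector_derivative_const]
    unfolding zen_def by simp
  moreover have "xen t = mirror_map hen (zen t)" if "t \<ge> 0" for t
  proof -
    have "(\<Sum>i=1..N. x i t) =
        (\<Sum>i=1..N. mirror_map (extend_infty X (h i)) (zen t + z i 0))"
    proof (rule sum.cong[OF refl])
      fix i
      assume i: "i \<in> {1..N}"
      show "x i t = mirror_map (extend_infty X (h i)) (zen t + z i 0)"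
        by (simp only: primal[OF i that] displacement[OF i that])
    qed
    then have "xen t = (1 / real N) *\<^sub>R
        (\<Sum>i=1..N. mirror_map (extend_infty X (h i)) (zen t + z i 0))"
      by (simp only: average[OF that])
    also have "\<dots> = mirror_map hen (zen t)"
      unfolding hen_def by (rule mirror_map_ensemble_regularizer[symmetric]) (use \<open>N \<ge> 1\<close> mm in auto)
    finally show ?thesis .
  qed
  moreover have "zen 0 = 0" by (simp add: zen_def)
  moreover have "has_mirror_map X hen"
    unfolding hen_def
    by (rule has_mirror_map_ensemble_regularizer) (use \<open>convex X\<close> \<open>N \<ge> 1\<close> mm in auto)
  ultimately show ?thesis by blast
qed

end
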